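(* Let $X$ be a finite dataset, $\epsilon\in\mathbb{R}$, and $MinPts\in\{1,2\}$. Let $\{\mathbb{B}_i\}_{i\in I}$ be a filtration of covers of $X$ by bins, and let DBSCAN with parameters $\epsilon$ and $MinPts$ be used to cluster each bin of each $\mathbb{B}_i$, giving cluster covers $\mathbb{C}_{\mathbb{B}_i}$. Then there is a filtration of cluster covers as bin size increases, i.e. a filtration $\{c^{\mathbb{B}_i,\mathbb{B}_j}:\mathbb{C}_{\mathbb{B}_i}\to\mathbb{C}_{\mathbb{B}_j},\ \forall\,\mathbb{B}_i\le\mathbb{B}_j\}$.
   Context: DBSCAN. Let $Y$ be a finite (ordered) set of points in a metric space, $\epsilon\in\mathbb{R}$, $MinPts$ a positive integer, and $N_\epsilon(p)=\{q\in Y: dist(p,q)\le\epsilon\}$ for $p\in Y$. A point $p\in Y$ is a core point if $|N_\epsilon(p)|\ge MinPts$; a border point if it is not core but lies in $N_\epsilon(p')$ for some core point $p'$; and noise otherwise. A point $q$ is directly density-reachable from $p$ if $p$ is core and $q\in N_\epsilon(p)$. A point $q$ is density-reachable from $p$ if there are points $p=\alpha_1,\dots,\alpha_n=q$ in $Y$, $n\ge 2$, with each $\alpha_{i+1}$ directly density-reachable from $\alpha_i$. Points $p,q$ are density-connected if there is a point $o\in Y$ from which both are density-reachable. DBSCAN outputs a partition $Y=C_1\sqcup\dots\sqcup C_n\sqcup N$, with $N$ the set of noise points and the clusters $C_i$, each containing at least one core point, satisfying: (Maximality) if $p\in C_i$, $q\notin \bigsqcup_{j<i}C_j$ and $q$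 is density-reachable from $p$, then $q\in C_i$; (Connectivity) any $p,q\in C_i$ are density-connected. Bins and cluster covers. A bin is a subset of $X$; $\mathbb{B}_i$ is a finite indexed collection of bins covering $X$. DBSCAN is run separately inside each bin (with $Y$ = the bin). The cluster cover $\mathbb{C}_{\mathbb{B}_i}$ is the family of all clusters so obtained, indexed by the bin they come from (clusters in different bins are different elements even if equal as sets); noise points belong to no cluster, and the word "cover" is used regardless. Filtration of covers. A family $\{\mathbb{U}_\lambda\}$ of covers indexed by a partially ordered parameter set is a filtration if it has maps $u^{\lambda,\mu}:\mathbb{U}_\lambda\to\mathbb{U}_\mu$ for $\lambda\le\mu$ such that $u^{\lambda,\mu}(U)=V$ implies $U\subseteq V$, and $u^{\mu,\nu}\circ u^{\lambda,\mu}=u^{\lambda,\nu}$ for $\lambda\le\mu\le\nu$. The same definition is used for cluster covers. For bin covers we write $\mathbb{B}_i\le\mathbb{B}_j$ (for $i\le j$), so every bin in $\mathbb{B}_i$ is contained in a bin of $\mathbb{B}_j$. *)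

theory Defs
  imports Complex_Main
begin

definition eps_nbhd :: "'a::metric_space set \<Rightarrow> real \<Rightarrow> 'a \<Rightarrow> 'a set" where
  "eps_nbhd Y \<epsilon> p = {q \<in> Y. dist p q \<le> \<epsilon>}"

definition core_point :: "'a::metric_space set \<Rightarrow> real \<Rightarrow> nat \<Rightarrow> 'a \<Rightarrow> bool" where
  "core_point Y \<epsilon> MinPts p \<longleftrightarrow> p \<in> Y \<and> MinPts \<le> card (eps_nbhd Y \<epsilon> p)"

definition border_point :: "'a::metric_space set \<Rightarrow> real \<Rightarrow> nat \<Rightarrow> 'a \<Rightarrow> bool" where
  "border_point Y \<epsilon> MinPts p \<longleftrightarrow>
     p \<in> Y \<and> \<not> core_point Y \<epsilon> MinPts p \<and>
     (\<exists>p'. core_point Y \<epsilon> MinPts p' \<and> p \<in> eps_nbhd Y \<epsilon> p')"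

definition noise :: "'a::metric_space set \<Rightarrow> real \<Rightarrow> nat \<Rightarrow> 'a set" where
  "noise Y \<epsilon> MinPts =
     {p \<in> Y. \<not> core_point Y \<epsilon> MinPts p \<and> \<not> border_point Y \<epsilon> MinPts p}"

(* In the next two relations the source p comes first: q is (directly) density-reachable from p. *)

definition directly_density_reachable ::
    "'a::metric_space set \<Rightarrow> real \<Rightarrow> nat \<Rightarrow> 'a \<Rightarrow> 'a \<Rightarrow> bool" where
  "directly_density_reachable Y \<epsilon> MinPts p q \<longleftrightarrow>
     core_point Y \<epsilon> MinPts p \<and> q \<in> eps_nbhd Y \<epsilon> p"

definition density_reachable ::
    "'a::metric_space set \<Rightarrow> real \<Rightarrow> nat \<Rightarrow> 'a \<Rightarrow> 'a \<Rightarrow> bool" where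
  "density_reachable Y \<epsilon> MinPts p q \<longleftrightarrow>
     (\<exists>\<alpha>. length \<alpha> \<ge> 2 \<and> set \<alpha> \<subseteq> Y \<and> hd \<alpha> = p \<and> last \<alpha> = q \<and>
          successively (directly_density_reachable Y \<epsilon> MinPts) \<alpha>)"

definition density_connected ::
    "'a::metric_space set \<Rightarrow> real \<Rightarrow> nat \<Rightarrow> 'a \<Rightarrow> 'a \<Rightarrow> bool" where
  "density_connected Y \<epsilon> MinPts p q \<longleftrightarrow>
     (\<exists>o'\<in>Y. density_reachable Y \<epsilon> MinPts o' p \<and> density_reachable Y \<epsilon> MinPts o' q)"

(* Cs lists the clusters in the order in which they are produced. The result of a run depends on
   the order in which the points of Y are visited, hence a predicate rather than a function of Y. *)

definition dbscan_output ::
    "'a::metric_space set \<Rightarrow> real \<Rightarrow> nat \<Rightarrow> 'a set list \<Rightarrow> bool" where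
  "dbscan_output Y \<epsilon> MinPts Cs \<longleftrightarrow>
     \<Union>(set Cs) \<union> noise Y \<epsilon> MinPts = Y \<and>
     \<Union>(set Cs) \<inter> noise Y \<epsilon> MinPts = {} \<and>
     (\<forall>i j. i < j \<and> j < length Cs \<longrightarrow> Cs ! i \<inter> Cs ! j = {}) \<and>
     (\<forall>C\<in>set Cs. \<exists>p\<in>C. core_point Y \<epsilon> MinPts p) \<and>
     (\<forall>i<length Cs. \<forall>p q. p \<in> Cs ! i \<and> q \<notin> (\<Union>j<i. Cs ! j) \<and>
        density_reachable Y \<epsilon> MinPts p q \<longrightarrow> q \<in> Cs ! i) \<and>
     (\<forall>C\<in>set Cs. \<forall>p\<in>C. \<forall>q\<in>C. density_connected Y \<epsilon> MinPts p q)"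

(* An indexed collection of sets is given by an index set A and a function U on it; distinct
   indices are distinct elements of the collection, even if they carry the same set. *)

definition bin_cover :: "'a set \<Rightarrow> 'b set \<Rightarrow> ('b \<Rightarrow> 'a set) \<Rightarrow> bool" where
  "bin_cover X A U \<longleftrightarrow> finite A \<and> (\<forall>a\<in>A. U a \<subseteq> X) \<and> X = (\<Union>a\<in>A. U a)"

(* The collections are not required to cover anything, since cluster covers omit the noise. *)

definition filtration ::
    "'i::order set \<Rightarrow> ('i \<Rightarrow> 'b set) \<Rightarrow> ('i \<Rightarrow> 'b \<Rightarrow> 'a set) \<Rightarrow> ('i \<Rightarrow> 'i \<Rightarrow> 'b \<Rightarrow> 'b) \<Rightarrow> bool" where
  "filtration I A U u \<longleftrightarrow>
     (\<forall>l\<in>I. \<forall>m\<in>I. l \<le> m \<longrightarrow>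
        u l m ` A l \<subseteq> A m \<and> (\<forall>a\<in>A l. U l a \<subseteq> U m (u l m a))) \<and>
     (\<forall>l\<in>I. \<forall>m\<in>I. \<forall>n\<in>I. l \<le> m \<and> m \<le> n \<longrightarrow>
        (\<forall>a\<in>A l. u m n (u l m a) = u l n a))"

(* Elements are pairs (index of a bin, cluster found in that bin); the underlying set is snd. *)

definition cluster_cover :: "'b set \<Rightarrow> ('b \<Rightarrow> 'a set list) \<Rightarrow> ('b \<times> 'a set) set" where
  "cluster_cover A Cs = (SIGMA a:A. set (Cs a))"

end

theory Submission
  imports Defs
begin

text \<open>
  For \<open>MinPts \<le> 2\<close>, direct density-reachability is a symmetric relation: if \<open>q\<close> is another point
  of the \<open>\<epsilon>\<close>-neighbourhood of a core point \<open>p\<close>, then \<open>p\<close> and \<open>q\<close> are already two points near \<open>q\<close>,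
  so \<open>q\<close> is a core point as well
  (\<open>directly_density_reachable_sym\<close>). Hence there are no border points, the only points whose
  cluster can depend on the order of the run, and in every DBSCAN output the clusters are the
  equivalence classes of density-reachability on the core points (\<open>density_connected_imp_reachable\<close>,
  \<open>cluster_closed\<close>).

  Enlarging the bin enlarges all neighbourhoods, so core points stay core points and chains of
  density-reachability stay such chains. Every class in a small bin therefore lies in a class of
  a larger bin (\<open>cluster_subset_cluster\<close>). That class is unique because clusters are disjoint and
  nonempty. The map sending a cluster to the unique cluster around it is then functorial:
  both sides of the composition law are clusters of the same bin that contain the given cluster.
\<close>

section \<open>Density-reachability as a transitive closure\<close>

lemma directly_density_reachable_mem:
  assumes "directly_density_reachable Y \<epsilon> k p q"
  shows "p \<in> Y" "q \<in> Y"
  using assms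
  by (auto simp: directly_density_reachable_def core_point_def eps_nbhd_def)

lemma successively_imp_tranclp:
  assumes "successively R xs" "length xs \<ge> 2"
  shows "R\<^sup>+\<^sup>+ (hd xs) (last xs)"
  using assms
proof (induction xs rule: induct_list012)
  case (3 x y zs)
  then show ?case
    by (cases zs) (auto intro: tranclp_into_tranclp2)
qed auto

text \<open>Chains of length at least two make reachability the transitive, not the reflexive
  transitive, closure: a noise point is not reachable from itself.\<close>

lemma density_reachable_iff_tranclp:
  "density_reachable Y \<epsilon> k p q \<longleftrightarrow> (directly_density_reachable Y \<epsilon> k)\<^sup>+\<^sup>+ p q"
proof
  assume "density_reachable Y \<epsilon> k p q"
  then show "(directly_density_reachable Y \<epsilon> k)\<^sup>+\<^sup>+ p q"
    using successively_imp_tranclp unfolding density_reachable_def by blast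
next
  assume "(directly_density_reachable Y \<epsilon> k)\<^sup>+\<^sup>+ p q"
  then show "density_reachable Y \<epsilon> k p q"
  proof (induction rule: tranclp_induct)
    case (base y)
    then show ?case
      using directly_density_reachable_mem[OF base]
      unfolding density_reachable_def by (intro exI[of _ "[p, y]"]) auto
  next
    case (step y z)
    then obtain xs where "length xs \<ge> 2" "set xs \<subseteq> Y" "hd xs = p" "last xs = y"
      "successively (directly_density_reachable Y \<epsilon> k) xs"
      unfolding density_reachable_def by blast
    then show ?case
      using step(2) directly_density_reachable_mem[OF step(2)]
      unfolding density_reachable_def
      by (intro exI[of _ "xs @ [z]"]) (auto simp: successively_append_iff hd_append)
  qed
qed

lemma density_reachable_trans:
  assumes "density_reachable Y \<epsilon> k p q" "density_reachable Y \<epsilon> k q r"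
  shows "density_reachable Y \<epsilon> k p r"
  using assms unfolding density_reachable_iff_tranclp by (rule tranclp_trans)

section \<open>Symmetry for at most two minimal points\<close>

lemma directly_density_reachable_sym:
  assumes "finite Y" "k \<le> 2" "directly_density_reachable Y \<epsilon> k p q"
  shows "directly_density_reachable Y \<epsilon> k q p"
proof (cases "p = q")
  case False
  have "p \<in> Y" "q \<in> Y" and pq: "dist p q \<le> \<epsilon>"
    using assms(3) by (auto simp: directly_density_reachable_def core_point_def eps_nbhd_def)
  moreover have "0 \<le> \<epsilon>"
    using pq zero_le_dist[of p q] by linarith
  ultimately have sub: "{p, q} \<subseteq> eps_nbhd Y \<epsilon> q"
    by (auto simp: eps_nbhd_def dist_commute)
  have "finite (eps_nbhd Y \<epsilon> q)"
    using assms(1) by (simp add: eps_nbhd_def)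
  then have "2 \<le> card (eps_nbhd Y \<epsilon> q)"
    using card_mono[OF _ sub] False by simp
  then show ?thesis
    using assms(2) sub \<open>q \<in> Y\<close> by (simp add: directly_density_reachable_def core_point_def)
qed (use assms in simp)

lemma density_reachable_sym:
  assumes "finite Y" "k \<le> 2" "density_reachable Y \<epsilon> k p q"
  shows "density_reachable Y \<epsilon> k q p"
proof -
  have "(directly_density_reachable Y \<epsilon> k)\<inverse>\<inverse> = directly_density_reachable Y \<epsilon> k"
    using directly_density_reachable_sym[OF assms(1,2)] by (auto simp: fun_eq_iff)
  then show ?thesis
    using assms(3) tranclp_converseI[of "directly_density_reachable Y \<epsilon> k" q p]
    by (simp add: density_reachable_iff_tranclp)
qed

text \<open>The last step of a chain that ends in \<open>p\<close> can be reversed, and only core points start a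
  step.\<close>

lemma density_reachable_imp_core_point:
  assumes "finite Y" "k \<le> 2" "density_reachable Y \<epsilon> k o' p"
  shows "core_point Y \<epsilon> k p"
proof -
  have "(directly_density_reachable Y \<epsilon> k)\<^sup>+\<^sup>+ o' p"
    using assms(3) by (simp add: density_reachable_iff_tranclp)
  then obtain r where "directly_density_reachable Y \<epsilon> k r p"
    by (blast elim: tranclp.cases)
  then show ?thesis
    using directly_density_reachable_sym[OF assms(1,2)] directly_density_reachable_def by blast
qed

lemma density_connected_imp_reachable:
  assumes "finite Y" "k \<le> 2" "density_connected Y \<epsilon> k p q"
  shows "density_reachable Y \<epsilon> k p q"
  using assms density_reachable_sym density_reachable_trans
  unfolding density_connected_def by metis

section \<open>Enlarging the bin\<close>

lemma core_point_mono:
  assumes "finite Z" "Y \<subseteq> Z" "core_point Y \<epsilon> k p"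
  shows "core_point Z \<epsilon> k p"
proof -
  have "card (eps_nbhd Y \<epsilon> p) \<le> card (eps_nbhd Z \<epsilon> p)"
    using assms(1,2) by (intro card_mono) (auto simp: eps_nbhd_def)
  then show ?thesis
    using assms(2,3) by (auto simp: core_point_def)
qed

lemma density_reachable_mono:
  assumes "finite Z" "Y \<subseteq> Z" "density_reachable Y \<epsilon> k p q"
  shows "density_reachable Z \<epsilon> k p q"
proof -
  have "directly_density_reachable Y \<epsilon> k \<le> directly_density_reachable Z \<epsilon> k"
    using core_point_mono[OF assms(1,2)] assms(2)
    by (auto simp: directly_density_reachable_def eps_nbhd_def)
  then show ?thesis
    using assms(3) trancl_mono[to_pred] unfolding density_reachable_iff_tranclp by blast
qed

section \<open>Clusters of a DBSCAN output\<close>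

lemma dbscan_cluster_nonempty:
  assumes "dbscan_output Y \<epsilon> k Cs" "C \<in> set Cs"
  shows "C \<noteq> {}"
  using assms unfolding dbscan_output_def by blast

lemma dbscan_cluster_index_unique:
  assumes "dbscan_output Y \<epsilon> k Cs" "i < length Cs" "j < length Cs"
    "p \<in> Cs ! i" "p \<in> Cs ! j"
  shows "i = j"
  using assms unfolding dbscan_output_def by (metis disjoint_iff linorder_neqE_nat)

lemma dbscan_cluster_unique:
  assumes "dbscan_output Y \<epsilon> k Cs" "C \<in> set Cs" "D \<in> set Cs" "p \<in> C" "p \<in> D"
  shows "C = D"
  using assms dbscan_cluster_index_unique by (metis in_set_conv_nth)

lemma core_point_in_cluster:
  assumes "dbscan_output Y \<epsilon> k Cs" "core_point Y \<epsilon> k p"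
  obtains C where "C \<in> set Cs" "p \<in> C"
proof -
  have "p \<in> Y" "p \<notin> noise Y \<epsilon> k"
    using assms(2) by (auto simp: core_point_def noise_def)
  moreover have "\<Union>(set Cs) \<union> noise Y \<epsilon> k = Y"
    using assms(1) by (simp add: dbscan_output_def)
  ultimately show ?thesis
    using that by blast
qed

text \<open>Maximality alone lets earlier clusters claim reachable points. Symmetry excludes this:
  the earlier cluster would have claimed the starting point too.\<close>

lemma cluster_closed:
  assumes "finite Y" "k \<le> 2" "dbscan_output Y \<epsilon> k Cs" "C \<in> set Cs" "p \<in> C"
    "density_reachable Y \<epsilon> k p q"
  shows "q \<in> C"
proof -
  have max: "s \<in> Cs ! i"
    if "i < length Cs" "r \<in> Cs ! i" "s \<notin> (\<Union>j<i. Cs ! j)" "density_reachable Y \<epsilon> k r s" for i r s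
    using assms(3) that unfolding dbscan_output_def by blast
  obtain i where i: "i < length Cs" "Cs ! i = C"
    using assms(4) by (metis in_set_conv_nth)
  have "q \<notin> Cs ! j" if "j < i" for j
  proof
    assume q: "q \<in> Cs ! j"
    have "p \<notin> Cs ! l" if "l < j" for l
      using dbscan_cluster_index_unique[OF assms(3), of l i p] that \<open>j < i\<close> i assms(5) by auto
    then have "p \<in> Cs ! j"
      using max[OF _ q] density_reachable_sym[OF assms(1,2,6)] that i(1) by auto
    then show False
      using dbscan_cluster_index_unique[OF assms(3), of j i p] that i assms(5) by auto
  qed
  then show ?thesis
    using max[OF i(1)] i(2) assms(5,6) by auto
qed

text \<open>Any \<open>p \<in> C\<close> stays a core point in \<open>Z\<close>, hence is not noise there and lies in some cluster \<open>D\<close>;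
  connectivity in \<open>Y\<close> makes the rest of \<open>C\<close> reachable from \<open>p\<close> in \<open>Z\<close>, and \<open>D\<close> is closed under
  reachability.\<close>

lemma cluster_subset_cluster:
  assumes "finite Z" "Y \<subseteq> Z" "k \<le> 2"
    and Y: "dbscan_output Y \<epsilon> k Cs" and Z: "dbscan_output Z \<epsilon> k Ds"
    and C: "C \<in> set Cs"
  shows "\<exists>!D. D \<in> set Ds \<and> C \<subseteq> D"
proof -
  have "finite Y"
    using assms(1,2) finite_subset by blast
  obtain p where p: "p \<in> C"
    using dbscan_cluster_nonempty[OF Y C] by blast
  have reach: "density_reachable Z \<epsilon> k p q" if "q \<in> C" for q
  proof -
    have "density_connected Y \<epsilon> k p q"
      using Y C p that unfolding dbscan_output_def by blast
    then show ?thesis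
      using density_connected_imp_reachable[OF \<open>finite Y\<close> assms(3)]
        density_reachable_mono[OF assms(1,2)] by blast
  qed
  have "core_point Z \<epsilon> k p"
    using density_reachable_imp_core_point[OF assms(1,3)] reach p by blast
  then obtain D where D: "D \<in> set Ds" "p \<in> D"
    using core_point_in_cluster[OF Z] by blast
  have "C \<subseteq> D"
    using cluster_closed[OF assms(1,3) Z D] reach by blast
  then show ?thesis
    using D p dbscan_cluster_unique[OF Z] by blast
qed

section \<open>The induced filtration of cluster covers\<close>

theorem corollary1:
  fixes X :: "'a::metric_space set" and \<epsilon> :: real and MinPts :: nat
    and I :: "'i::order set"
    and A :: "'i \<Rightarrow> 'b set" and B :: "'i \<Rightarrow> 'b \<Rightarrow> 'a set"
    and b :: "'i \<Rightarrow> 'i \<Rightarrow> 'b \<Rightarrow> 'b"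
    and Cs :: "'i \<Rightarrow> 'b \<Rightarrow> 'a set list"
  assumes "finite X"
    and "MinPts \<in> {1, 2}"
    and "\<forall>i\<in>I. bin_cover X (A i) (B i)"
    and "filtration I A B b"
    and "\<forall>i\<in>I. \<forall>a\<in>A i. dbscan_output (B i a) \<epsilon> MinPts (Cs i a)"
  shows "\<exists>c. filtration I (\<lambda>i. cluster_cover (A i) (Cs i)) (\<lambda>i. snd) c"
proof -
  have fin: "finite (B i a)" if "i \<in> I" "a \<in> A i" for i a
    using assms(1,3) that unfolding bin_cover_def by (meson finite_subset)
  have out: "dbscan_output (B i a) \<epsilon> MinPts (Cs i a)" if "i \<in> I" "a \<in> A i" for i a
    using assms(5) that by blast
  have b_mem: "b l m a \<in> A m" and b_sub: "B l a \<subseteq> B m (b l m a)"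
    if "l \<in> I" "m \<in> I" "l \<le> m" "a \<in> A l" for l m a
    using assms(4) that unfolding filtration_def by blast+
  have b_comp: "b m n (b l m a) = b l n a"
    if "l \<in> I" "m \<in> I" "n \<in> I" "l \<le> m" "m \<le> n" "a \<in> A l" for l m n a
    using assms(4) that unfolding filtration_def by blast
  define g where "g l m a C = (THE D. D \<in> set (Cs m (b l m a)) \<and> C \<subseteq> D)" for l m a C
  have ex1: "\<exists>!D. D \<in> set (Cs m (b l m a)) \<and> C \<subseteq> D"
    if "l \<in> I" "m \<in> I" "l \<le> m" "a \<in> A l" "C \<in> set (Cs l a)" for l m a C
  proof (rule cluster_subset_cluster)
    show "MinPts \<le> 2" using assms(2) by auto
    show "dbscan_output (B l a) \<epsilon> MinPts (Cs l a)"
      using that out by blast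
    show "dbscan_output (B m (b l m a)) \<epsilon> MinPts (Cs m (b l m a))"
      using that b_mem out by blast
  qed (use that b_mem b_sub fin in auto)
  have g: "g l m a C \<in> set (Cs m (b l m a))" "C \<subseteq> g l m a C"
    if "l \<in> I" "m \<in> I" "l \<le> m" "a \<in> A l" "C \<in> set (Cs l a)" for l m a C
    using theI'[OF ex1[OF that]] unfolding g_def by auto
  have g_comp: "g m n (b l m a) (g l m a C) = g l n a C"
    if "l \<in> I" "m \<in> I" "n \<in> I" "l \<le> m" "m \<le> n" "a \<in> A l" "C \<in> set (Cs l a)" for l m n a C
  proof -
    let ?D = "g m n (b l m a) (g l m a C)"
    have "l \<le> n"
      using that(4,5) by (rule order_trans)
    have "?D \<in> set (Cs n (b l n a)) \<and> C \<subseteq> ?D"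
      using g[of m n "b l m a" "g l m a C"] g[of l m a C] b_mem[of l m a] b_comp[of l m n a] that
      by auto
    then show ?thesis
      using ex1[of l n a C] g[of l n a C] that \<open>l \<le> n\<close> by blast
  qed
  have "filtration I (\<lambda>i. cluster_cover (A i) (Cs i)) (\<lambda>i. snd)
      (\<lambda>l m (a, C). (b l m a, g l m a C))"
    unfolding filtration_def cluster_cover_def
    using b_mem b_comp g g_comp by (auto dest: subsetD)
  then show ?thesis by blast
qed

end
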